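(* Let $r,n\ge 1$ be integers. Then $$\sum_{\pi\in G(r,n)}(-1)^{\mathrm{rinv}(\pi)}q^{\mathrm{fmaj}(\pi)} = \prod_{k=1}^n[r]_{(-1)^kq}\,[k]_{(-1)^{k-1}q^r}$$ and $$\sum_{\pi\in G(r,n)}(-1)^{\mathrm{fmaj}(\pi)}q^{\mathrm{rinv}(\pi)} = \prod_{k=1}^n[r]_{-q^k}\,[k]_{(-1)^{(k-1)r}q}.$$
   Context: For an integer $m\ge 0$ and any quantity $p$, $[m]_p:=1+p+\cdots+p^{m-1}$. $G(r,n)=C_r\wr\mathfrak S_n$ is the group of $r$-colored permutations; an element is a word $\pi=\pi_1\cdots\pi_n=\sigma_1^{[z_1]}\cdots\sigma_n^{[z_n]}$ with $\sigma\in\mathfrak S_n$ and colors $z_i\in\{0,1,\dots,r-1\}$, with $i^{[0]}=i$. The colored letters are ordered linearly by $$(1^{[r-1]}<\cdots<n^{[r-1]})<\cdots<(1^{[1]}<\cdots<n^{[1]})<(1<\cdots<n),$$ and with respect to this order $\mathrm{inv}(\pi):=|\{(i,j):i<j,\ \pi_i>\pi_j\}|$ and $\mathrm{maj}(\pi):=\sum_{1\le i\le n-1,\ \pi_i>\pi_{i+1}} i$. The flag major index is $\mathrm{fmaj}(\pi):=r\cdot\mathrm{maj}(\pi)+\sum_{i=1}^n z_i$, and the root inversion number is $\mathrm{rinv}(\pi):=\mathrm{inv}(\pi)+\sum_{i=1}^n z_i\sigma_i$. *)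

theory Defs
  imports "HOL-Library.FuncSet" "HOL-Combinatorics.Permutations"
begin

definition qnum :: "nat \<Rightarrow> 'a::comm_ring_1 \<Rightarrow> 'a" where
  "qnum m p = (\<Sum>i<m. p ^ i)"

text \<open>
  An \<open>r\<close>-colored permutation is a pair \<open>(\<sigma>, z)\<close>, standing for the word whose \<open>i\<close>-th letter is
  \<open>\<sigma> i\<close> with color \<open>z i\<close>: the color is indexed by the position, not by the underlying value.
  Both components are pinned down outside \<open>{1..n}\<close> (as the identity and as \<open>undefined\<close>,
  respectively), so that every word is represented exactly once.
\<close>

type_synonym colored_perm = "(nat \<Rightarrow> nat) \<times> (nat \<Rightarrow> nat)"

definition colored_perms :: "nat \<Rightarrow> nat \<Rightarrow> colored_perm set" where
  "colored_perms r n = {\<sigma>. \<sigma> permutes {1..n}} \<times> ({1..n} \<rightarrow>\<^sub>E {0..<r})"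

text \<open>A colored letter is a pair (value, color).\<close>

definition letter :: "colored_perm \<Rightarrow> nat \<Rightarrow> nat \<times> nat" where
  "letter \<pi> i = (fst \<pi> i, snd \<pi> i)"

text \<open>Letters of larger color come first; within a color, letters are ordered by value.\<close>

definition letter_less :: "nat \<times> nat \<Rightarrow> nat \<times> nat \<Rightarrow> bool" where
  "letter_less x y \<longleftrightarrow> snd y < snd x \<or> (snd x = snd y \<and> fst x < fst y)"

definition inv_num :: "nat \<Rightarrow> colored_perm \<Rightarrow> nat" where
  "inv_num n \<pi> =
     card {(i, j). i \<in> {1..n} \<and> j \<in> {1..n} \<and> i < j \<and> letter_less (letter \<pi> j) (letter \<pi> i)}"

definition maj :: "nat \<Rightarrow> colored_perm \<Rightarrow> nat" where
  "maj n \<pi> = (\<Sum>i | 1 \<le> i \<and> i < n \<and> letter_less (letter \<pi> (i + 1)) (letter \<pi> i). i)"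

definition fmaj :: "nat \<Rightarrow> nat \<Rightarrow> colored_perm \<Rightarrow> nat" where
  "fmaj r n \<pi> = r * maj n \<pi> + (\<Sum>i = 1..n. snd \<pi> i)"

definition rinv :: "nat \<Rightarrow> colored_perm \<Rightarrow> nat" where
  "rinv n \<pi> = inv_num n \<pi> + (\<Sum>i = 1..n. snd \<pi> i * fst \<pi> i)"

end

theory Submission
  imports Defs
begin

text \<open>
  A colored permutation is determined by two independent pieces of data: the color \<open>c v\<close> carried by
  each value \<open>v\<close>, and the uncolored permutation \<open>\<tau>\<close> obtained by replacing every letter by its rank
  among the letters of the word.  The statistics \<open>inv_num\<close> and \<open>maj\<close> see only the relative order of
  the letters, hence only \<open>\<tau>\<close>; the remaining terms of \<open>rinv\<close> and \<open>fmaj\<close>, which are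
  \<open>\<Sum>v. c v * v\<close> and \<open>\<Sum>v. c v\<close>, see only \<open>c\<close>.  Both generating functions therefore factor
  (\<open>colored_inv_maj_sum\<close>).  The sum over \<open>c\<close> is a product over \<open>v\<close> of geometric sums, which are
  the factors \<open>qnum r\<close>.  What remains is the joint distribution of inversion number and major index
  on uncolored permutations, evaluated where one of the two variables is a sign.

  That distribution is computed by refining it by the last letter.  Appending a last letter \<open>b\<close> to a
  permutation of \<open>{1..n}\<close> with last letter \<open>a\<close> creates \<open>n + 1 - b\<close> inversions, and it adds \<open>n\<close> to the
  major index unless \<open>a < b\<close>; this is the recursion \<open>inv_maj_sum_last_Suc\<close>.

  If inversions are counted with a sign \<open>s\<close>, the refined sums at size \<open>n + 1\<close> form a geometric
  progression with ratio \<open>p = s ^ n * q\<close>.  Since \<open>p ^ (n + 1) = q ^ (n + 1)\<close>, the recursion merely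
  rotates this progression, and it becomes geometric with ratio \<open>s * p\<close> at the next size
  (\<open>signed_inv_sum_last\<close>).

  If the major index is counted with a sign \<open>t\<close>, then a descent at position \<open>n\<close> is invisible
  whenever \<open>t ^ n = 1\<close>, so that appending a letter multiplies the sum by \<open>[n + 1]\<close> at \<open>q\<close>.
  Otherwise \<open>t = - 1\<close> and \<open>n\<close> is odd; the step before was then of the invisible kind, and the last
  two letters can be summed out together (\<open>signed_last_letters_sum\<close>).
\<close>

section \<open>Inversions and major index of uncolored permutations\<close>

definition perm_inv :: "nat \<Rightarrow> (nat \<Rightarrow> nat) \<Rightarrow> nat" where
  "perm_inv n \<sigma> = card {(i, j). i \<in> {1..n} \<and> j \<in> {1..n} \<and> i < j \<and> \<sigma> j < \<sigma> i}"

definition perm_maj :: "nat \<Rightarrow> (nat \<Rightarrow> nat) \<Rightarrow> nat" where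
  "perm_maj n \<sigma> = (\<Sum>i | 1 \<le> i \<and> i < n \<and> \<sigma> (i + 1) < \<sigma> i. i)"

definition inv_maj_sum :: "nat \<Rightarrow> 'a::comm_ring_1 \<Rightarrow> 'a \<Rightarrow> 'a" where
  "inv_maj_sum n x y = (\<Sum>\<sigma> | \<sigma> permutes {1..n}. x ^ perm_inv n \<sigma> * y ^ perm_maj n \<sigma>)"

definition inv_maj_sum_last :: "nat \<Rightarrow> nat \<Rightarrow> 'a::comm_ring_1 \<Rightarrow> 'a \<Rightarrow> 'a" where
  "inv_maj_sum_last n b x y =
     (\<Sum>\<sigma> | \<sigma> permutes {1..n} \<and> \<sigma> n = b. x ^ perm_inv n \<sigma> * y ^ perm_maj n \<sigma>)"

lemma sum_by_last_letter:
  fixes n :: nat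
  assumes "n \<ge> 1"
  shows "(\<Sum>\<sigma> | \<sigma> permutes {1..n}. h \<sigma>) =
           (\<Sum>a = 1..n. \<Sum>\<sigma> | \<sigma> permutes {1..n} \<and> \<sigma> n = a. h \<sigma>)"
proof -
  have "(\<Sum>a = 1..n. \<Sum>\<sigma> | \<sigma> \<in> {\<sigma>. \<sigma> permutes {1..n}} \<and> \<sigma> n = a. h \<sigma>) =
          (\<Sum>\<sigma> | \<sigma> permutes {1..n}. h \<sigma>)"
  proof (rule sum.group)
    show "(\<lambda>\<sigma>. \<sigma> n) ` {\<sigma>. \<sigma> permutes {1..n}} \<subseteq> {1..n}"
    proof safe
      fix \<sigma> assume "\<sigma> permutes {1..n}"
      from permutes_in_image[OF this, of n] assms show "\<sigma> n \<in> {1..n}" by auto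
    qed
  qed (auto simp: finite_permutations)
  then show ?thesis by simp
qed

corollary inv_maj_sum_by_last:
  assumes "n \<ge> 1"
  shows "inv_maj_sum n x y = (\<Sum>a = 1..n. inv_maj_sum_last n a x y)"
  unfolding inv_maj_sum_def inv_maj_sum_last_def by (rule sum_by_last_letter[OF assms])

text \<open>
  The relabelling that frees the value \<open>b\<close> for a new last letter: it raises the values \<open>b, \<dots>, n\<close> by
  one, keeping their relative order, and sends \<open>n + 1\<close> to \<open>b\<close>.  Since a permutation of \<open>{1..n}\<close> fixes
  the position \<open>n + 1\<close>, composing it with this cycle appends the letter \<open>b\<close> to the word.
\<close>

definition raise_from :: "nat \<Rightarrow> nat \<Rightarrow> nat \<Rightarrow> nat" where
  "raise_from n b v = (if v = Suc n then b else if b \<le> v \<and> v \<le> n then Suc v else v)"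

lemma raise_from_permutes:
  assumes "b \<in> {1..Suc n}"
  shows "raise_from n b permutes {1..Suc n}"
  by (rule inj_imp_permutes)
     (use assms in \<open>auto simp: raise_from_def inj_on_def split: if_splits\<close>)

lemma bij_betw_append_last:
  assumes b: "b \<in> {1..Suc n}"
  shows "bij_betw (\<lambda>\<tau>. raise_from n b \<circ> \<tau>) {\<tau>. \<tau> permutes {1..n}}
           {\<sigma>. \<sigma> permutes {1..Suc n} \<and> \<sigma> (Suc n) = b}"
proof (rule bij_betw_byWitness[where f' = "\<lambda>\<sigma>. inv (raise_from n b) \<circ> \<sigma>"])
  note c = raise_from_permutes[OF b]
  show "\<forall>\<tau>\<in>{\<tau>. \<tau> permutes {1..n}}. inv (raise_from n b) \<circ> (raise_from n b \<circ> \<tau>) = \<tau>"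
    using permutes_inverses[OF c] by (auto simp: fun_eq_iff)
  show "\<forall>\<sigma>\<in>{\<sigma>. \<sigma> permutes {1..Suc n} \<and> \<sigma> (Suc n) = b}.
          raise_from n b \<circ> (inv (raise_from n b) \<circ> \<sigma>) = \<sigma>"
    using permutes_inverses[OF c] by (auto simp: fun_eq_iff)
  show "(\<lambda>\<tau>. raise_from n b \<circ> \<tau>) ` {\<tau>. \<tau> permutes {1..n}} \<subseteq>
          {\<sigma>. \<sigma> permutes {1..Suc n} \<and> \<sigma> (Suc n) = b}"
  proof safe
    fix \<tau> assume \<tau>: "\<tau> permutes {1..n}"
    then have "\<tau> permutes {1..Suc n}" by (rule permutes_subset) auto
    then show "raise_from n b \<circ> \<tau> permutes {1..Suc n}" by (rule permutes_compose[OF _ c])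
    have "\<tau> (Suc n) = Suc n" using permutes_not_in[OF \<tau>] by simp
    then show "(raise_from n b \<circ> \<tau>) (Suc n) = b" by (simp add: raise_from_def)
  qed
  show "(\<lambda>\<sigma>. inv (raise_from n b) \<circ> \<sigma>) ` {\<sigma>. \<sigma> permutes {1..Suc n} \<and> \<sigma> (Suc n) = b} \<subseteq>
          {\<tau>. \<tau> permutes {1..n}}"
  proof safe
    fix \<sigma> assume \<sigma>: "\<sigma> permutes {1..Suc n}" and b: "b = \<sigma> (Suc n)"
    have p: "inv (raise_from n (\<sigma> (Suc n))) \<circ> \<sigma> permutes {1..Suc n}"
      using \<sigma> c unfolding b by (intro permutes_compose permutes_inv)
    have "raise_from n b (Suc n) = b" by (simp add: raise_from_def)
    then have "inv (raise_from n b) b = Suc n" using permutes_inverses(2)[OF c, of "Suc n"] by simp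
    then show "inv (raise_from n (\<sigma> (Suc n))) \<circ> \<sigma> permutes {1..n}"
      unfolding b by (intro permutes_superset[OF p]) (auto simp: le_Suc_eq)
  qed
qed

text \<open>
  The new letter \<open>b\<close> is inverted with exactly those letters that were raised.
\<close>

lemma perm_inv_append:
  assumes b: "b \<in> {1..Suc n}" and \<tau>: "\<tau> permutes {1..n}"
  shows "perm_inv (Suc n) (raise_from n b \<circ> \<tau>) = perm_inv n \<tau> + (Suc n - b)"
proof -
  let ?\<sigma> = "raise_from n b \<circ> \<tau>"
  have in_range: "\<tau> i \<in> {1..n} \<longleftrightarrow> i \<in> {1..n}" for i by (rule permutes_in_image[OF \<tau>])
  have last: "\<tau> (Suc n) = Suc n" using permutes_not_in[OF \<tau>] by simp
  have "{(i, j). i \<in> {1..Suc n} \<and> j \<in> {1..Suc n} \<and> i < j \<and> ?\<sigma> j < ?\<sigma> i} =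
        {(i, j). i \<in> {1..n} \<and> j \<in> {1..n} \<and> i < j \<and> \<tau> j < \<tau> i} \<union>
        (\<lambda>i. (i, Suc n)) ` {i \<in> {1..n}. b \<le> \<tau> i}" (is "?A = ?B \<union> ?C")
  proof (rule set_eqI, clarify)
    fix i j
    show "(i, j) \<in> ?A \<longleftrightarrow> (i, j) \<in> ?B \<union> ?C"
      using in_range[of i] in_range[of j] last b
      by (cases "j = Suc n"; cases "i = Suc n") (auto simp: raise_from_def)
  qed
  moreover have "finite ?B" by (rule finite_subset[of _ "{1..n} \<times> {1..n}"]) auto
  moreover have "?B \<inter> ?C = {}" by auto
  ultimately have "perm_inv (Suc n) ?\<sigma> = perm_inv n \<tau> + card ?C"
    unfolding perm_inv_def by (simp add: card_Un_disjoint)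
  moreover have "card ?C = card {i \<in> {1..n}. b \<le> \<tau> i}"
    by (rule card_image) (simp add: inj_on_def)
  moreover have "card {i \<in> {1..n}. b \<le> \<tau> i} = card {b..n}"
  proof (rule bij_betw_same_card[where f = \<tau>], rule bij_betw_imageI)
    show "inj_on \<tau> {i \<in> {1..n}. b \<le> \<tau> i}"
      using permutes_inj[OF \<tau>] by (auto intro: inj_on_subset)
    have "v \<in> \<tau> ` {i \<in> {1..n}. b \<le> \<tau> i}" if "v \<in> {b..n}" for v
    proof (rule image_eqI)
      show "v = \<tau> (inv \<tau> v)" by (simp add: permutes_inverses(1)[OF \<tau>])
      with that in_range[of "inv \<tau> v"] b show "inv \<tau> v \<in> {i \<in> {1..n}. b \<le> \<tau> i}" by auto
    qed
    with in_range show "\<tau> ` {i \<in> {1..n}. b \<le> \<tau> i} = {b..n}" by fastforce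
  qed
  ultimately show ?thesis by simp
qed

lemma perm_maj_append:
  assumes b: "b \<in> {1..Suc n}" and \<tau>: "\<tau> permutes {1..n}" and n: "n \<ge> 1"
  shows "perm_maj (Suc n) (raise_from n b \<circ> \<tau>) = perm_maj n \<tau> + (if \<tau> n < b then 0 else n)"
proof -
  let ?\<sigma> = "raise_from n b \<circ> \<tau>"
  have in_range: "\<tau> i \<in> {1..n} \<longleftrightarrow> i \<in> {1..n}" for i by (rule permutes_in_image[OF \<tau>])
  have last: "\<tau> (Suc n) = Suc n" using permutes_not_in[OF \<tau>] by simp
  have "{i. 1 \<le> i \<and> i < Suc n \<and> ?\<sigma> (i + 1) < ?\<sigma> i} =
        {i. 1 \<le> i \<and> i < n \<and> \<tau> (i + 1) < \<tau> i} \<union> (if \<tau> n < b then {} else {n})" (is "?A = ?B \<union> ?C")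
  proof (rule set_eqI)
    fix i
    show "i \<in> ?A \<longleftrightarrow> i \<in> ?B \<union> ?C"
      using in_range[of i] in_range[of "Suc i"] last b n
      by (cases "i = n") (auto simp: raise_from_def)
  qed
  moreover have "finite ?B" by simp
  ultimately show ?thesis unfolding perm_maj_def by (simp add: sum.union_disjoint)
qed

text \<open>
  The case distinction is on \<open>a < b\<close> although the letter \<open>a\<close> may itself be raised: the appended word
  has a descent at \<open>n\<close> exactly if the old last letter is raised, that is, if \<open>b \<le> a\<close>.
\<close>

lemma inv_maj_sum_last_Suc:
  assumes b: "b \<in> {1..Suc n}" and n: "n \<ge> 1"
  shows "inv_maj_sum_last (Suc n) b x y =
           x ^ (Suc n - b) * (\<Sum>a = 1..n. (if a < b then 1 else y ^ n) * inv_maj_sum_last n a x y)"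
proof -
  have "inv_maj_sum_last (Suc n) b x y =
          (\<Sum>\<tau> | \<tau> permutes {1..n}. x ^ perm_inv (Suc n) (raise_from n b \<circ> \<tau>) *
             y ^ perm_maj (Suc n) (raise_from n b \<circ> \<tau>))"
    unfolding inv_maj_sum_last_def
    by (rule sum.reindex_bij_betw[OF bij_betw_append_last[OF b], symmetric])
  also have "\<dots> = (\<Sum>\<tau> | \<tau> permutes {1..n}. x ^ (Suc n - b) *
      ((if \<tau> n < b then 1 else y ^ n) * (x ^ perm_inv n \<tau> * y ^ perm_maj n \<tau>)))"
    by (rule sum.cong) (auto simp: perm_inv_append[OF b] perm_maj_append[OF b _ n] power_add)
  also have "\<dots> = x ^ (Suc n - b) * (\<Sum>a = 1..n. (if a < b then 1 else y ^ n) * inv_maj_sum_last n a x y)"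
    unfolding inv_maj_sum_last_def sum_distrib_left[symmetric]
    by (subst sum_by_last_letter[OF n]) (auto simp: sum_distrib_left intro!: sum.cong)
  finally show ?thesis .
qed

lemma inv_maj_sum_0 [simp]: "inv_maj_sum 0 x y = 1"
  by (simp add: inv_maj_sum_def perm_inv_def perm_maj_def)

lemma inv_maj_sum_last_1 [simp]: "inv_maj_sum_last (Suc 0) (Suc 0) x y = 1"
proof -
  have "{\<sigma>::nat \<Rightarrow> nat. \<sigma> permutes {1..Suc 0} \<and> \<sigma> (Suc 0) = Suc 0} = {id}"
    by auto
  moreover have "perm_inv (Suc 0) id = 0" "perm_maj (Suc 0) id = 0"
    by (auto simp: perm_inv_def perm_maj_def card_eq_0_iff)
  ultimately show ?thesis by (simp add: inv_maj_sum_last_def)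
qed

section \<open>Summation identities for \<open>q\<close>-integers\<close>

lemma qnum_Suc: "qnum (Suc m) p = qnum m p + p ^ m"
  by (simp add: qnum_def)

lemma qnum_rev: "(\<Sum>a = 1..m. p ^ (m - a)) = qnum m p"
  unfolding qnum_def
  by (rule sum.reindex_bij_witness[where i = "\<lambda>i. m - i" and j = "\<lambda>a. m - a"]) auto

lemma one_minus_times_qnum: "(1 - p) * qnum m p = 1 - p ^ m"
  by (simp add: qnum_def one_diff_power_eq)

text \<open>
  The exponents occurring on the left are a block of \<open>m\<close> consecutive integers: those below
  \<open>m + 1 - b\<close> are moved up by \<open>m\<close>, so \<open>0, \<dots>, m - 1\<close> becomes \<open>m + 1 - b, \<dots>, 2 * m - b\<close>.
  The proof moves one exponent at a time, starting from \<open>b = m + 1\<close>, where nothing is moved.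
\<close>

lemma qnum_rotate:
  assumes "b \<in> {1..Suc m}"
  shows "(\<Sum>a = 1..m. (if a < b then 1 else p ^ m) * p ^ (m - a)) = p ^ (Suc m - b) * qnum m p"
proof -
  have "(\<Sum>a = 1..m. (if a < Suc m - d then 1 else p ^ m) * p ^ (m - a)) = p ^ d * qnum m p"
    if "d \<le> m" for d
    using that
  proof (induction d)
    case 0
    then show ?case by (simp add: qnum_rev[symmetric])
  next
    case (Suc d)
    then have a0: "m - d \<in> {1..m}" by auto
    let ?f = "\<lambda>d a. (if a < Suc m - d then 1 else p ^ m) * p ^ (m - a)"
    have "(\<Sum>a \<in> {1..m}. ?f (Suc d) a) = ?f (Suc d) (m - d) + (\<Sum>a \<in> {1..m} - {m - d}. ?f (Suc d) a)"
      using a0 by (intro sum.remove) auto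
    also have "(\<Sum>a \<in> {1..m} - {m - d}. ?f (Suc d) a) = (\<Sum>a \<in> {1..m} - {m - d}. ?f d a)"
      by (rule sum.cong) auto
    also have "\<dots> = (\<Sum>a \<in> {1..m}. ?f d a) - ?f d (m - d)"
      using sum.remove[OF _ a0, of "?f d"] by simp
    also have "?f (Suc d) (m - d) = p ^ m * p ^ d" using Suc.prems by simp
    also have "?f d (m - d) = p ^ d" using Suc.prems by (simp add: Suc_diff_le)
    also have "(\<Sum>a \<in> {1..m}. ?f d a) = p ^ d * qnum m p" using Suc by simp
    also have "p ^ m * p ^ d + (p ^ d * qnum m p - p ^ d) = p ^ d * (qnum m p - (1 - p ^ m))"
      by (simp add: algebra_simps)
    also have "\<dots> = p ^ Suc d * qnum m p"
      by (simp add: one_minus_times_qnum[symmetric] algebra_simps)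
    finally show ?case .
  qed
  from this[of "Suc m - b"] assms show ?thesis by auto
qed

text \<open>
  A pair with \<open>k < i\<close> has sign \<open>- 1\<close>; mapping it to \<open>(k, i - 1)\<close> makes it a pair with \<open>i \<le> k\<close> whose
  exponent is smaller by one.  So each pair with \<open>i \<le> k\<close> contributes \<open>1 - q\<close> times its weight.
\<close>

lemma signed_pairs_sum:
  "(\<Sum>i<Suc n. \<Sum>k<n. (if i \<le> k then 1 else - 1) * q ^ (i + k)) =
     (1 - q) * (\<Sum>k<n. q ^ k * qnum (Suc k) (q::'a::comm_ring_1))"
proof (induction n)
  case (Suc n)
  let ?f = "\<lambda>i k. (if i \<le> k then 1 else - 1) * q ^ (i + k)"
  have "(\<Sum>i<Suc (Suc n). \<Sum>k<Suc n. ?f i k) =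
          (\<Sum>i<Suc n. \<Sum>k<n. ?f i k) + (\<Sum>i<Suc n. ?f i n) + (\<Sum>k<Suc n. ?f (Suc n) k)"
    by (simp add: sum.distrib algebra_simps)
  also have "(\<Sum>i<Suc n. ?f i n) = q ^ n * qnum (Suc n) q"
    unfolding qnum_def sum_distrib_left by (rule sum.cong) (auto simp: power_add mult.commute)
  also have "(\<Sum>k<Suc n. ?f (Suc n) k) = - (q * (q ^ n * qnum (Suc n) q))"
    unfolding qnum_def sum_distrib_left sum_negf[symmetric]
    by (rule sum.cong) (auto simp: power_add mult_ac)
  also have "(\<Sum>i<Suc n. \<Sum>k<n. ?f i k) + q ^ n * qnum (Suc n) q + - (q * (q ^ n * qnum (Suc n) q)) =
      (1 - q) * ((\<Sum>k<n. q ^ k * qnum (Suc k) q) + q ^ n * qnum (Suc n) q)"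
    unfolding Suc.IH by (simp add: algebra_simps)
  also have "(\<Sum>k<n. q ^ k * qnum (Suc k) q) + q ^ n * qnum (Suc n) q =
      (\<Sum>k<Suc n. q ^ k * qnum (Suc k) q)"
    by simp
  finally show ?case .
qed simp

text \<open>
  For an odd number \<open>N\<close> of summands the sum on the left is the Gaussian binomial coefficient
  \<open>[N] * [N + 1] / (1 + q)\<close>, and \<open>(1 - q) / (1 + q)\<close> turns the even \<open>q\<close>-integer \<open>[N + 1]\<close> into the
  one at \<open>- q\<close>.  Since \<open>1 + q\<close> need not be invertible, the product formula is proved by induction.
\<close>

lemma sum_qnum_odd:
  "(1 - q) * (\<Sum>k<Suc (2 * m). q ^ k * qnum (Suc k) (q::'a::comm_ring_1)) =
     qnum (Suc (2 * m)) q * qnum (Suc (Suc (2 * m))) (- q)"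
proof (induction m)
  case 0
  then show ?case by (simp add: qnum_def)
next
  case (Suc m)
  define N where "N = Suc (2 * m)"
  have N: "Suc (2 * Suc m) = Suc (Suc N)" by (simp add: N_def)
  have even: "(- q) ^ Suc N = q ^ Suc N" "(- q) ^ N = - (q ^ N)" by (simp_all add: N_def)
  have geo: "(1 + q) * qnum (Suc N) (- q) = (1 - q) * qnum (Suc N) q"
    using one_minus_times_qnum[of "- q" "Suc N"] one_minus_times_qnum[of q "Suc N"]
    by (simp only: even minus_minus diff_minus_eq_add)
  have "qnum (Suc (Suc N)) q * qnum (Suc (Suc (Suc N))) (- q) =
          (qnum N q + q ^ N * (1 + q)) * qnum (Suc N) (- q)
          + qnum (Suc (Suc N)) q * (q ^ Suc N * (1 - q))"
    using even by (simp add: qnum_Suc algebra_simps)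
  also have "(qnum N q + q ^ N * (1 + q)) * qnum (Suc N) (- q) =
      qnum N q * qnum (Suc N) (- q) + q ^ N * ((1 + q) * qnum (Suc N) (- q))"
    by (simp only: algebra_simps)
  also have "\<dots> = (1 - q) * (\<Sum>k<N. q ^ k * qnum (Suc k) q) + q ^ N * ((1 - q) * qnum (Suc N) q)"
    using Suc.IH geo unfolding N_def by simp
  also have "\<dots> + qnum (Suc (Suc N)) q * (q ^ Suc N * (1 - q)) =
      (1 - q) * (\<Sum>k<Suc (Suc N). q ^ k * qnum (Suc k) q)"
    by (simp add: algebra_simps)
  finally show ?case unfolding N ..
qed

text \<open>
  The weight of the last two letters when the major index is counted with the sign \<open>- 1\<close> and a
  descent at the odd position \<open>n\<close> flips the sign: \<open>b\<close> is the last letter and \<open>a\<close> the one before it,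
  measured before \<open>b\<close> was appended.
\<close>

lemma signed_last_letters_sum:
  fixes q :: "'a::comm_ring_1"
  assumes "odd n"
  shows "(\<Sum>b = 1..Suc n. q ^ (Suc n - b) * (\<Sum>a = 1..n. (if a < b then 1 else - 1) * q ^ (n - a))) =
           qnum n q * qnum (Suc n) (- q)"
proof -
  obtain m where m: "n = Suc (2 * m)" using assms by (auto elim: oddE)
  have "(\<Sum>b = 1..Suc n. q ^ (Suc n - b) * (\<Sum>a = 1..n. (if a < b then 1 else - 1) * q ^ (n - a))) =
        (\<Sum>b = 1..Suc n. \<Sum>a = 1..n. (if a < b then 1 else - 1) * q ^ ((Suc n - b) + (n - a)))"
    by (simp only: sum_distrib_left power_add mult_ac)
  also have "\<dots> = (\<Sum>i<Suc n. \<Sum>k<n. (if i \<le> k then 1 else - 1) * q ^ (i + k))"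
  proof (rule sum.reindex_bij_witness[where i = "\<lambda>i. Suc n - i" and j = "\<lambda>b. Suc n - b"])
    fix b assume b: "b \<in> {1..Suc n}"
    show "(\<Sum>k<n. (if Suc n - b \<le> k then 1 else - 1) * q ^ (Suc n - b + k)) =
            (\<Sum>a = 1..n. (if a < b then 1 else - 1) * q ^ ((Suc n - b) + (n - a)))"
      using b by (intro sum.reindex_bij_witness[where i = "\<lambda>a. n - a" and j = "\<lambda>k. n - k"]) auto
  qed auto
  finally show ?thesis by (simp only: signed_pairs_sum m sum_qnum_odd)
qed

section \<open>The two signed Mahonian identities\<close>

text \<open>
  Because \<open>n * (n + 1)\<close> is even, the sign disappears from \<open>(s ^ n * q) ^ (n + 1)\<close>.
\<close>

lemma sign_power_triangle:
  assumes "s * s = (1::'a::comm_ring_1)"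
  shows "(s ^ n) ^ Suc n = 1"
proof -
  have "even (n * Suc n)" by simp
  then obtain k where "n * Suc n = 2 * k" by (elim evenE)
  then show ?thesis using assms by (simp only: power_mult[symmetric]) (simp add: power_mult power2_eq_square)
qed

text \<open>
  The geometric progression of the refined sums.  In the induction step the recursion weights the
  terms with \<open>b \<le> a\<close> by \<open>q ^ (n + 1)\<close>, which equals \<open>p ^ (n + 1)\<close> for the current ratio \<open>p\<close>; by
  \<open>qnum_rotate\<close> the result is a power of \<open>p\<close> times the full sum, and the sign coming from the new
  inversions changes the ratio to \<open>s * p\<close>.
\<close>

lemma signed_inv_sum_last:
  fixes s q :: "'a::comm_ring_1"
  assumes s: "s * s = 1" and "a \<in> {1..Suc n}"
  shows "inv_maj_sum_last (Suc n) a s q = inv_maj_sum n s q * (s ^ n * q) ^ (Suc n - a)"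
  using assms(2)
proof (induction n arbitrary: a)
  case 0
  then show ?case by simp
next
  case (Suc n b)
  define p where "p = s ^ n * q"
  have IH: "inv_maj_sum_last (Suc n) a s q = inv_maj_sum n s q * p ^ (Suc n - a)"
    if "a \<in> {1..Suc n}" for a
    using Suc.IH[OF that] by (simp add: p_def)
  have q: "q ^ Suc n = p ^ Suc n"
    by (simp only: p_def power_mult_distrib sign_power_triangle[OF s] mult_1)
  have total: "inv_maj_sum (Suc n) s q = inv_maj_sum n s q * qnum (Suc n) p"
    by (subst inv_maj_sum_by_last)
       (auto simp: IH qnum_rev[symmetric] sum_distrib_left simp del: sum.cl_ivl_Suc)
  have "inv_maj_sum_last (Suc (Suc n)) b s q =
      s ^ (Suc (Suc n) - b) * (\<Sum>a = 1..Suc n. (if a < b then 1 else q ^ Suc n) * inv_maj_sum_last (Suc n) a s q)"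
    using Suc.prems by (intro inv_maj_sum_last_Suc) auto
  also have "(\<Sum>a = 1..Suc n. (if a < b then 1 else q ^ Suc n) * inv_maj_sum_last (Suc n) a s q) =
      inv_maj_sum n s q * (\<Sum>a = 1..Suc n. (if a < b then 1 else p ^ Suc n) * p ^ (Suc n - a))"
    unfolding sum_distrib_left by (rule sum.cong) (auto simp: IH q simp del: power_Suc)
  also have "(\<Sum>a = 1..Suc n. (if a < b then 1 else p ^ Suc n) * p ^ (Suc n - a)) =
      p ^ (Suc (Suc n) - b) * qnum (Suc n) p"
    by (rule qnum_rotate[OF Suc.prems])
  also have "s ^ (Suc (Suc n) - b) * (inv_maj_sum n s q * (p ^ (Suc (Suc n) - b) * qnum (Suc n) p)) =
      inv_maj_sum (Suc n) s q * (s * p) ^ (Suc (Suc n) - b)"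
    by (simp only: total power_mult_distrib mult_ac)
  also have "s * p = s ^ Suc n * q" by (simp add: p_def mult_ac)
  finally show ?case .
qed

lemma signed_inv_maj_sum:
  fixes s q :: "'a::comm_ring_1"
  assumes s: "s * s = 1"
  shows "inv_maj_sum n s q = (\<Prod>k = 1..n. qnum k (s ^ (k - 1) * q))"
proof (induction n)
  case (Suc n)
  have "inv_maj_sum (Suc n) s q = (\<Sum>a = 1..Suc n. inv_maj_sum n s q * (s ^ n * q) ^ (Suc n - a))"
    by (subst inv_maj_sum_by_last)
       (auto intro!: sum.cong signed_inv_sum_last[OF s] simp del: sum.cl_ivl_Suc)
  also have "\<dots> = inv_maj_sum n s q * qnum (Suc n) (s ^ n * q)"
    by (simp only: sum_distrib_left[symmetric] qnum_rev)
  finally show ?case by (simp add: Suc.IH)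
qed simp

text \<open>
  If \<open>t ^ n = 1\<close>, a descent at position \<open>n\<close> has weight one, so the refined sum depends on the last
  letter \<open>b\<close> only through the inversions that \<open>b\<close> creates.
\<close>

lemma inv_sum_last_of_trivial_descent:
  fixes t q :: "'a::comm_ring_1"
  assumes t: "t ^ n = 1" and b: "b \<in> {1..Suc n}"
  shows "inv_maj_sum_last (Suc n) b q t = inv_maj_sum n q t * q ^ (Suc n - b)"
proof (cases "n = 0")
  case True
  with b show ?thesis by simp
next
  case False
  then show ?thesis
    by (subst inv_maj_sum_last_Suc[OF b])
       (simp_all add: t inv_maj_sum_by_last mult.commute cong: if_cong)
qed

text \<open>
  When \<open>t ^ n = - 1\<close> the refined sums at size \<open>n + 1\<close> need not be geometric, but their
  total still factors.  It is reached from size \<open>n - 1\<close>, since \<open>t ^ (n - 1) = 1\<close> makes the refined sums at size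
  \<open>n\<close> geometric.
\<close>

lemma signed_maj_sum_Suc:
  fixes t q :: "'a::comm_ring_1"
  assumes t: "t = 1 \<or> t = - 1"
  shows "inv_maj_sum (Suc n) q t = inv_maj_sum n q t * qnum (Suc n) (t ^ n * q)"
proof (cases "t ^ n = 1")
  case True
  have "inv_maj_sum (Suc n) q t = (\<Sum>a = 1..Suc n. inv_maj_sum n q t * q ^ (Suc n - a))"
    by (subst inv_maj_sum_by_last)
       (auto intro!: sum.cong inv_sum_last_of_trivial_descent[OF True] simp del: sum.cl_ivl_Suc)
  also have "\<dots> = inv_maj_sum n q t * qnum (Suc n) q"
    by (simp only: sum_distrib_left[symmetric] qnum_rev)
  finally show ?thesis by (simp add: True)
next
  case False
  with t have t: "t = - 1" and odd: "odd n" by (auto simp: power_one uminus_power_if split: if_splits)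
  then obtain m where n: "n = Suc m" and tm: "t ^ m = 1" by (cases n) (auto simp: t)
  have tn: "t ^ n = - 1" using odd t by simp
  have inner: "inv_maj_sum_last n a q t = inv_maj_sum m q t * q ^ (n - a)" if "a \<in> {1..n}" for a
    using inv_sum_last_of_trivial_descent[OF tm] that unfolding n .
  have total: "inv_maj_sum n q t = inv_maj_sum m q t * qnum n q"
    using odd by (subst inv_maj_sum_by_last)
      (auto simp: inner qnum_rev[symmetric] sum_distrib_left Suc_le_eq odd_pos)
  have "inv_maj_sum (Suc n) q t = (\<Sum>b = 1..Suc n. inv_maj_sum_last (Suc n) b q t)"
    by (rule inv_maj_sum_by_last) simp
  also have "\<dots> = (\<Sum>b = 1..Suc n. inv_maj_sum m q t *
      (q ^ (Suc n - b) * (\<Sum>a = 1..n. (if a < b then 1 else - 1) * q ^ (n - a))))"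
  proof (rule sum.cong[OF refl])
    fix b assume b: "b \<in> {1..Suc n}"
    have "(\<Sum>a = 1..n. (if a < b then 1 else t ^ n) * inv_maj_sum_last n a q t) =
        inv_maj_sum m q t * (\<Sum>a = 1..n. (if a < b then 1 else - 1) * q ^ (n - a))"
      unfolding sum_distrib_left by (rule sum.cong) (auto simp: inner tn)
    then show "inv_maj_sum_last (Suc n) b q t = inv_maj_sum m q t *
      (q ^ (Suc n - b) * (\<Sum>a = 1..n. (if a < b then 1 else - 1) * q ^ (n - a)))"
      using inv_maj_sum_last_Suc[OF b, of q t] n by (simp add: mult_ac)
  qed
  also have "\<dots> = inv_maj_sum m q t * (qnum n q * qnum (Suc n) (- q))"
    by (simp only: sum_distrib_left[symmetric] signed_last_letters_sum[OF odd])
  finally show ?thesis by (simp add: total tn mult_ac)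
qed

lemma inv_signed_maj_sum:
  fixes t q :: "'a::comm_ring_1"
  assumes t: "t = 1 \<or> t = - 1"
  shows "inv_maj_sum n q t = (\<Prod>k = 1..n. qnum k (t ^ (k - 1) * q))"
proof (induction n)
  case (Suc n)
  then show ?case by (simp add: signed_maj_sum_Suc[OF t])
qed simp

section \<open>Separating colors from order\<close>

text \<open>
  The rank of the letter with value \<open>v\<close> and color \<open>c v\<close> among all letters of a word whose values are
  colored by \<open>c\<close>.  The count includes the letter itself, so that ranks start at 1; outside \<open>{1..n}\<close>
  the function is the identity in order to be a permutation of \<open>{1..n}\<close>.
\<close>

definition color_rank :: "nat \<Rightarrow> (nat \<Rightarrow> nat) \<Rightarrow> nat \<Rightarrow> nat" where
  "color_rank n c v =
     (if v \<in> {1..n} then card {u \<in> {1..n}. \<not> letter_less (v, c v) (u, c u)} else v)"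

lemma color_rank_mono:
  assumes "u \<in> {1..n}" "v \<in> {1..n}" "letter_less (u, c u) (v, c v)"
  shows "color_rank n c u < color_rank n c v"
proof -
  have "{w \<in> {1..n}. \<not> letter_less (u, c u) (w, c w)} \<subset> {w \<in> {1..n}. \<not> letter_less (v, c v) (w, c w)}"
    using assms by (intro psubsetI) (auto simp: letter_less_def)
  then show ?thesis using assms by (auto simp: color_rank_def intro!: psubset_card_mono)
qed

lemma color_rank_less_iff:
  assumes uv: "u \<in> {1..n}" "v \<in> {1..n}"
  shows "color_rank n c u < color_rank n c v \<longleftrightarrow> letter_less (u, c u) (v, c v)"
proof -
  have "u = v \<or> letter_less (u, c u) (v, c v) \<or> letter_less (v, c v) (u, c u)"
    by (auto simp: letter_less_def)
  then show ?thesis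
    using color_rank_mono[OF uv, of c] color_rank_mono[OF uv(2,1), of c]
    by (auto simp: letter_less_def)
qed

lemma color_rank_permutes: "color_rank n c permutes {1..n}"
proof (rule inj_imp_permutes)
  show "inj_on (color_rank n c) {1..n}"
  proof (rule inj_onI)
    fix u v assume uv: "u \<in> {1..n}" "v \<in> {1..n}" and eq: "color_rank n c u = color_rank n c v"
    have "u = v \<or> letter_less (u, c u) (v, c v) \<or> letter_less (v, c v) (u, c u)"
      by (auto simp: letter_less_def)
    then show "u = v"
      using color_rank_mono[OF uv, of c] color_rank_mono[OF uv(2,1), of c] eq by auto
  qed
  fix v assume v: "v \<in> {1..n}"
  let ?A = "{u \<in> {1..n}. \<not> letter_less (v, c v) (u, c u)}"
  have "v \<in> ?A" using v by (simp add: letter_less_def)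
  then have "0 < card ?A" by (auto simp: card_gt_0_iff)
  moreover have "card ?A \<le> card {1..n}" by (rule card_mono) auto
  ultimately show "color_rank n c v \<in> {1..n}" using v by (simp add: color_rank_def)
qed (auto simp: color_rank_def)

text \<open>
  A word with underlying permutation \<open>\<sigma>\<close> whose values are colored by \<open>c\<close> has the color \<open>c (\<sigma> i)\<close> at
  position \<open>i\<close>.  Its letters compare like the entries of the standardization \<open>color_rank n c \<circ> \<sigma>\<close>.
\<close>

lemma letter_less_iff_color_rank:
  assumes \<sigma>: "\<sigma> permutes {1..n}" and "i \<in> {1..n}" "j \<in> {1..n}"
  shows "letter_less (letter (\<sigma>, restrict (c \<circ> \<sigma>) {1..n}) j) (letter (\<sigma>, restrict (c \<circ> \<sigma>) {1..n}) i)
           \<longleftrightarrow> (color_rank n c \<circ> \<sigma>) j < (color_rank n c \<circ> \<sigma>) i"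
  using assms permutes_in_image[OF \<sigma>] by (simp add: letter_def color_rank_less_iff del: atLeastAtMost_iff)

lemma inv_num_eq_perm_inv:
  assumes \<sigma>: "\<sigma> permutes {1..n}"
  shows "inv_num n (\<sigma>, restrict (c \<circ> \<sigma>) {1..n}) = perm_inv n (color_rank n c \<circ> \<sigma>)"
  unfolding inv_num_def perm_inv_def
  by (rule arg_cong[where f = card])
     (auto simp: letter_less_iff_color_rank[OF \<sigma>] simp del: o_apply One_nat_def)

lemma maj_eq_perm_maj:
  assumes \<sigma>: "\<sigma> permutes {1..n}"
  shows "maj n (\<sigma>, restrict (c \<circ> \<sigma>) {1..n}) = perm_maj n (color_rank n c \<circ> \<sigma>)"
  unfolding maj_def perm_maj_def
  by (rule sum.cong) (auto simp: letter_less_iff_color_rank[OF \<sigma>] simp del: o_apply One_nat_def)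

text \<open>
  Passes from colors indexed by positions to colors indexed by values.
\<close>

lemma sum_colorings_by_value:
  assumes \<sigma>: "\<sigma> permutes A"
  shows "(\<Sum>z \<in> A \<rightarrow>\<^sub>E R. h z) = (\<Sum>c \<in> A \<rightarrow>\<^sub>E R. h (restrict (c \<circ> \<sigma>) A))"
proof (rule sum.reindex_bij_witness[where i = "\<lambda>c. restrict (c \<circ> \<sigma>) A" and
    j = "\<lambda>z. restrict (z \<circ> inv \<sigma>) A"])
  note mem = permutes_in_image[OF \<sigma>] permutes_in_image[OF permutes_inv[OF \<sigma>]]
  show restore: "restrict (restrict (z \<circ> inv \<sigma>) A \<circ> \<sigma>) A = z" if "z \<in> A \<rightarrow>\<^sub>E R" for z
    using that mem permutes_inverses[OF \<sigma>] by (auto simp: fun_eq_iff restrict_def PiE_def extensional_def)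
  show "restrict (restrict (c \<circ> \<sigma>) A \<circ> inv \<sigma>) A = c" if "c \<in> A \<rightarrow>\<^sub>E R" for c
    using that mem permutes_inverses[OF \<sigma>] by (auto simp: fun_eq_iff restrict_def PiE_def extensional_def)
  show "restrict (z \<circ> inv \<sigma>) A \<in> A \<rightarrow>\<^sub>E R" "restrict (z \<circ> \<sigma>) A \<in> A \<rightarrow>\<^sub>E R" if "z \<in> A \<rightarrow>\<^sub>E R" for z
    using that mem by (auto simp: PiE_def Pi_def)
  show "h (restrict (restrict (z \<circ> inv \<sigma>) A \<circ> \<sigma>) A) = h z" if "z \<in> A \<rightarrow>\<^sub>E R" for z
    by (simp only: restore[OF that])
qed

text \<open>
  For a fixed coloring \<open>c\<close> of the values, \<open>\<sigma> \<mapsto> color_rank n c \<circ> \<sigma>\<close> permutes the permutations of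
  \<open>{1..n}\<close>; hence the sum over \<open>\<sigma>\<close> does not depend on \<open>c\<close> and can be taken out.
\<close>

lemma colored_inv_maj_sum:
  fixes x y :: "'a::comm_ring_1" and g :: "nat \<Rightarrow> nat \<Rightarrow> 'a"
  shows "(\<Sum>\<pi>\<in>colored_perms r n. x ^ inv_num n \<pi> * y ^ maj n \<pi> * (\<Prod>i = 1..n. g (fst \<pi> i) (snd \<pi> i)))
           = inv_maj_sum n x y * (\<Prod>v = 1..n. \<Sum>c<r. g v c)"
proof -
  let ?S = "{\<sigma>. \<sigma> permutes {1..n}}" and ?C = "{1..n} \<rightarrow>\<^sub>E {0..<r}"
  have "(\<Sum>\<pi>\<in>colored_perms r n. x ^ inv_num n \<pi> * y ^ maj n \<pi> * (\<Prod>i = 1..n. g (fst \<pi> i) (snd \<pi> i))) =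
      (\<Sum>\<sigma>\<in>?S. \<Sum>z\<in>?C. x ^ inv_num n (\<sigma>, z) * y ^ maj n (\<sigma>, z) * (\<Prod>i = 1..n. g (\<sigma> i) (z i)))"
    by (simp add: colored_perms_def sum.cartesian_product split_def)
  also have "\<dots> = (\<Sum>\<sigma>\<in>?S. \<Sum>c\<in>?C. x ^ perm_inv n (color_rank n c \<circ> \<sigma>) *
      y ^ perm_maj n (color_rank n c \<circ> \<sigma>) * (\<Prod>v = 1..n. g v (c v)))"
  proof (rule sum.cong[OF refl], clarify)
    fix \<sigma> assume \<sigma>: "\<sigma> permutes {1..n}"
    have "(\<Prod>i = 1..n. g (\<sigma> i) (restrict (c \<circ> \<sigma>) {1..n} i)) = (\<Prod>v = 1..n. g v (c v))" for c
      by (subst prod.permute[OF \<sigma>]) simp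
    then show "(\<Sum>z\<in>?C. x ^ inv_num n (\<sigma>, z) * y ^ maj n (\<sigma>, z) * (\<Prod>i = 1..n. g (\<sigma> i) (z i))) =
      (\<Sum>c\<in>?C. x ^ perm_inv n (color_rank n c \<circ> \<sigma>) *
        y ^ perm_maj n (color_rank n c \<circ> \<sigma>) * (\<Prod>v = 1..n. g v (c v)))"
      by (subst sum_colorings_by_value[OF \<sigma>])
         (simp only: inv_num_eq_perm_inv[OF \<sigma>] maj_eq_perm_maj[OF \<sigma>])
  qed
  also have "\<dots> = (\<Sum>c\<in>?C. \<Sum>\<sigma>\<in>?S. x ^ perm_inv n (color_rank n c \<circ> \<sigma>) *
      y ^ perm_maj n (color_rank n c \<circ> \<sigma>) * (\<Prod>v = 1..n. g v (c v)))"
    by (rule sum.swap)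
  also have "\<dots> = (\<Sum>c\<in>?C. inv_maj_sum n x y * (\<Prod>v = 1..n. g v (c v)))"
    unfolding inv_maj_sum_def sum_distrib_right
    by (intro sum.cong refl setum_permutations_compose_left[OF color_rank_permutes, symmetric])
  also have "\<dots> = inv_maj_sum n x y * (\<Prod>v = 1..n. \<Sum>c<r. g v c)"
    by (simp add: sum_distrib_left[symmetric] prod_sum_PiE atLeast0LessThan)
  finally show ?thesis .
qed

theorem theorem5p6:
  fixes r n :: nat and q :: "'a::comm_ring_1"
  assumes "r \<ge> 1" and "n \<ge> 1"
  shows "(\<Sum>\<pi>\<in>colored_perms r n. (-1) ^ rinv n \<pi> * q ^ fmaj r n \<pi>) =
           (\<Prod>k = 1..n. qnum r ((-1) ^ k * q) * qnum k ((-1) ^ (k - 1) * q ^ r))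
       \<and> (\<Sum>\<pi>\<in>colored_perms r n. (-1) ^ fmaj r n \<pi> * q ^ rinv n \<pi>) =
           (\<Prod>k = 1..n. qnum r (- (q ^ k)) * qnum k ((-1) ^ ((k - 1) * r) * q))"
proof
  have "(-1) ^ rinv n \<pi> * q ^ fmaj r n \<pi> = (-1) ^ inv_num n \<pi> * (q ^ r) ^ maj n \<pi> *
          (\<Prod>i = 1..n. ((-1) ^ fst \<pi> i * q) ^ snd \<pi> i)" for \<pi>
    by (simp add: rinv_def fmaj_def power_add power_sum power_mult[symmetric] power_mult_distrib
        prod.distrib mult_ac)
  then have "(\<Sum>\<pi>\<in>colored_perms r n. (-1) ^ rinv n \<pi> * q ^ fmaj r n \<pi>) =
      inv_maj_sum n (-1) (q ^ r) * (\<Prod>v = 1..n. \<Sum>c<r. ((-1) ^ v * q) ^ c)"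
    by (simp only: colored_inv_maj_sum[where g = "\<lambda>v c. ((-1) ^ v * q) ^ c"])
  then show "(\<Sum>\<pi>\<in>colored_perms r n. (-1) ^ rinv n \<pi> * q ^ fmaj r n \<pi>) =
           (\<Prod>k = 1..n. qnum r ((-1) ^ k * q) * qnum k ((-1) ^ (k - 1) * q ^ r))"
    by (simp add: signed_inv_maj_sum qnum_def[of r] prod.distrib mult.commute)
next
  have "(-1) ^ fmaj r n \<pi> * q ^ rinv n \<pi> = q ^ inv_num n \<pi> * ((-1) ^ r) ^ maj n \<pi> *
          (\<Prod>i = 1..n. (- 1 * q ^ fst \<pi> i) ^ snd \<pi> i)" for \<pi>
    by (simp only: rinv_def fmaj_def power_add power_sum power_mult[symmetric] power_mult_distrib
        prod.distrib mult_ac)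
  then have "(\<Sum>\<pi>\<in>colored_perms r n. (-1) ^ fmaj r n \<pi> * q ^ rinv n \<pi>) =
      inv_maj_sum n q ((-1) ^ r) * (\<Prod>v = 1..n. \<Sum>c<r. (- 1 * q ^ v) ^ c)"
    by (simp only: colored_inv_maj_sum[where g = "\<lambda>v c. (- 1 * q ^ v) ^ c"])
  moreover have "(-1) ^ r = (1::'a) \<or> (-1) ^ r = (- 1::'a)"
    by (cases "even r") auto
  ultimately show "(\<Sum>\<pi>\<in>colored_perms r n. (-1) ^ fmaj r n \<pi> * q ^ rinv n \<pi>) =
           (\<Prod>k = 1..n. qnum r (- (q ^ k)) * qnum k ((-1) ^ ((k - 1) * r) * q))"
    by (simp add: inv_signed_maj_sum qnum_def[of r] prod.distrib power_mult[symmetric] mult.commute)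
qed

end
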